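(* Let $X$ and $Y$ be reflexive and strictly convex real Banach spaces, let $A\colon X\to Y$ be a bounded linear operator with metric generalized inverse $A^\dagger\colon\mathcal D(A^\dagger)\subset Y\to X$, and let $(X_k)_k$, $X_k\colon Y\to X$, be any sequential regularization. Let $y\in Y$. Either $y\in\mathcal D(A^\dagger)$, and there is the minimum norm solution $x_\ast(y)=A^\dagger y$, and then $X_k y\to x_\ast(y)$ in $X$ as $k\to\infty$; or $y\notin\mathcal D(A^\dagger)$, and then $\|X_k y\|_X\to\infty$ as $k\to\infty$.
   Context: $\mathcal N(A)\subset X$ is the null-space and $\mathcal R(A)\subset Y$ the (not necessarily closed) range of $A$. For a closed linear subspace $U$ of a reflexive strictly convex Banach space $Z$, the metric projection $\pi_U\colon Z\to U$ maps $z$ to the unique element of $U$ with $\|z-\pi_U(z)\|=\inf_{u\in U}\|z-u\|$. The duality map is $J_X(x)=\{x'\in X' : \langle x',x\rangle=\|x\|_X^2=\|x'\|_{X'}^2\}$, similarly $J_Y$. Put $C_X(A)=\{x\in X: J_X(x)\cap\mathcal N(A)^\perp\neq\emptyset\}$ and $C_Y(A)=\{y\in Y: J_Y(y)\cap\mathcal R(A)^\perp\ne\emptyset\}$, where $\perp$ denotes annihilators in the dual spaces; then $X=\mathcal N(A)+C_X(A)$ and $Y=\overline{\mathcal R(A)}+C_Y(A)$, with $y-\pi_{\overline{\mathcal R(A)}}y\in C_Y(A)$ for all $y\in Y$, and $A$ maps $C_X(A)$ injectively onto $\mathcal R(A)$. The metric generalized inverse $A^\dagger$ has domain $\mathcal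 D(A^\dagger)=\mathcal R(A)+C_Y(A)=\{y\in Y:\pi_{\overline{\mathcal R(A)}}y\in\mathcal R(A)\}$ and is given by $A^\dagger y=(A|_{C_X(A)})^{-1}(\pi_{\overline{\mathcal R(A)}}y)$. For $y\in\mathcal D(A^\dagger)$, $x_\ast(y):=A^\dagger y$ is the minimum norm solution, i.e. the unique element of minimal norm among all minimizers of $x\mapsto\|Ax-y\|_Y$ over $X$. A sequence of homogeneous mappings $X_k\colon Y\to X$ (i.e. $X_k(\lambda y)=\lambda X_k(y)$ for all $\lambda\in\mathbb R$) is called a (sequential) regularization if, as $k\to\infty$, $X_ky\to A^\dagger y$ for all $y\in\mathcal D(A^\dagger)$ and $AX_ky\to\pi_{\overline{\mathcal R(A)}}y$ for all $y\in Y$ (norm convergence). *)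

theory Defs
  imports "HOL-Analysis.Analysis"
begin

text \<open>The dual of a real normed space \<open>'a\<close> is the type \<open>'a \<Rightarrow>\<^sub>L real\<close>, with the operator norm.
  Reflexivity is surjectivity of the canonical embedding into the bidual.\<close>

definition reflexive_space :: "'a::real_normed_vector itself \<Rightarrow> bool" where
  "reflexive_space _ \<longleftrightarrow>
    (\<forall>\<phi> :: ('a \<Rightarrow>\<^sub>L real) \<Rightarrow>\<^sub>L real. \<exists>x :: 'a. \<forall>f. blinfun_apply \<phi> f = blinfun_apply f x)"

definition strictly_convex_space :: "'a::real_normed_vector itself \<Rightarrow> bool" where
  "strictly_convex_space _ \<longleftrightarrow>
    (\<forall>x y :: 'a. norm x = 1 \<longrightarrow> norm y = 1 \<longrightarrow> x \<noteq> y \<longrightarrow> norm ((1 / 2) *\<^sub>R (x + y)) < 1)"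

definition metric_projection :: "'a::real_normed_vector set \<Rightarrow> 'a \<Rightarrow> 'a" where
  "metric_projection U z = (THE u. u \<in> U \<and> norm (z - u) = (INF v\<in>U. norm (z - v)))"

definition duality_map :: "'a::real_normed_vector \<Rightarrow> ('a \<Rightarrow>\<^sub>L real) set" where
  "duality_map x = {f. blinfun_apply f x = (norm x)\<^sup>2 \<and> (norm x)\<^sup>2 = (norm f)\<^sup>2}"

definition annihilator :: "'a::real_normed_vector set \<Rightarrow> ('a \<Rightarrow>\<^sub>L real) set" where
  "annihilator M = {f. \<forall>x\<in>M. blinfun_apply f x = 0}"

definition null_space :: "('a::real_normed_vector \<Rightarrow>\<^sub>L 'b::real_normed_vector) \<Rightarrow> 'a set" where
  "null_space A = {x. blinfun_apply A x = 0}"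

definition range_space :: "('a::real_normed_vector \<Rightarrow>\<^sub>L 'b::real_normed_vector) \<Rightarrow> 'b set" where
  "range_space A = range (blinfun_apply A)"

definition C_dom :: "('a::real_normed_vector \<Rightarrow>\<^sub>L 'b::real_normed_vector) \<Rightarrow> 'a set" where
  "C_dom A = {x. duality_map x \<inter> annihilator (null_space A) \<noteq> {}}"

definition C_cod :: "('a::real_normed_vector \<Rightarrow>\<^sub>L 'b::real_normed_vector) \<Rightarrow> 'b set" where
  "C_cod A = {y. duality_map y \<inter> annihilator (range_space A) \<noteq> {}}"

definition mgi_domain :: "('a::real_normed_vector \<Rightarrow>\<^sub>L 'b::real_normed_vector) \<Rightarrow> 'b set" where
  "mgi_domain A = {r + c | r c. r \<in> range_space A \<and> c \<in> C_cod A}"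

text \<open>The metric generalized inverse is a partial map; as a HOL function it is total, and
  its values are meaningful only on \<open>mgi_domain A\<close>.\<close>

definition mgi :: "('a::real_normed_vector \<Rightarrow>\<^sub>L 'b::real_normed_vector) \<Rightarrow> 'b \<Rightarrow> 'a" where
  "mgi A y = the_inv_into (C_dom A) (blinfun_apply A)
      (metric_projection (closure (range_space A)) y)"

definition residual_minimizer ::
    "('a::real_normed_vector \<Rightarrow>\<^sub>L 'b::real_normed_vector) \<Rightarrow> 'b \<Rightarrow> 'a \<Rightarrow> bool" where
  "residual_minimizer A y x \<longleftrightarrow> is_arg_min (\<lambda>z. norm (blinfun_apply A z - y)) (\<lambda>_. True) x"

text \<open>Uniqueness is part of the notion: \<open>x\<close> is the only residual minimizer of minimal norm.\<close>

definition minimum_norm_solution ::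
    "('a::real_normed_vector \<Rightarrow>\<^sub>L 'b::real_normed_vector) \<Rightarrow> 'b \<Rightarrow> 'a \<Rightarrow> bool" where
  "minimum_norm_solution A y x \<longleftrightarrow>
    (\<forall>z. is_arg_min norm (residual_minimizer A y) z \<longleftrightarrow> z = x)"

definition homogeneous_map :: "('b::real_vector \<Rightarrow> 'a::real_vector) \<Rightarrow> bool" where
  "homogeneous_map F \<longleftrightarrow> (\<forall>(c::real) y. F (c *\<^sub>R y) = c *\<^sub>R F y)"

definition sequential_regularization ::
    "('a::real_normed_vector \<Rightarrow>\<^sub>L 'b::real_normed_vector) \<Rightarrow> (nat \<Rightarrow> 'b \<Rightarrow> 'a) \<Rightarrow> bool" where
  "sequential_regularization A X \<longleftrightarrow>
    (\<forall>k. homogeneous_map (X k)) \<and>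
    (\<forall>y\<in>mgi_domain A. (\<lambda>k. X k y) \<longlonglongrightarrow> mgi A y) \<and>
    (\<forall>y. (\<lambda>k. blinfun_apply A (X k y)) \<longlonglongrightarrow> metric_projection (closure (range_space A)) y)"

end

theory Submission
  imports Defs
begin

text \<open>
  If \<open>y\<close> lies in the domain of the inverse, convergence is part of the notion of a
  regularization, and what has to be shown is that \<open>mgi A y\<close> is the minimum norm solution.
  Otherwise, if \<open>\<parallel>X k y\<parallel>\<close> did not tend to infinity, some of the \<open>X k y\<close>
  with arbitrarily large \<open>k\<close> would stay in a ball.  The image of a ball of a reflexive
  space under \<open>A\<close> is closed, so the limit of \<open>A (X k y)\<close>, the projection of \<open>y\<close> onto the
  closure of the range, would be attained by \<open>A\<close>, which puts \<open>y\<close> into the domain: a contradiction.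

  Both halves reduce the duality maps to best approximation.  A vector \<open>x\<close> has a duality
  functional that annihilates a subspace iff no element of the subspace is closer to \<open>x\<close> than
  \<open>0\<close> (\<open>duality_map_annihilator_iff\<close>).  Hence \<open>C_dom A\<close> consists of the norm-minimal elements
  of the fibres of \<open>A\<close>, and \<open>mgi_domain A\<close> of the \<open>y\<close> whose residual \<open>\<parallel>A x - y\<parallel>\<close>
  attains its minimum.  Reflexivity gives existence of best approximations in closed subspaces,
  strict convexity gives their uniqueness; so a nonempty fibre has exactly one norm-minimal
  element, and the inverse picks it in the fibre over the projection of \<open>y\<close>.

  The analytic core is the Hahn--Banach theorem for sublinear functionals.  It is used
  on the spaces themselves with the distance to a subspace as sublinear functional, to produce
  annihilating functionals, and on the dual space, with the upper limit of \<open>f (x i)\<close> as a sublinear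
  functional of \<open>f\<close>.  In the latter case reflexivity represents the dominated linear functional
  by a point, which behaves like a weak cluster point of \<open>x\<close>
  (\<open>reflexive_weak_cluster_point\<close>).
\<close>

section \<open>Sublinear functionals and the Hahn--Banach theorem\<close>

definition sublinear :: "('a::real_vector \<Rightarrow> real) \<Rightarrow> bool" where
  "sublinear p \<longleftrightarrow> (\<forall>v w. p (v + w) \<le> p v + p w) \<and> (\<forall>c v. c > 0 \<longrightarrow> p (c *\<^sub>R v) = c * p v)"

lemma sublinear_add: "sublinear p \<Longrightarrow> p (v + w) \<le> p v + p w"
  by (simp add: sublinear_def)

lemma sublinear_scale: "sublinear p \<Longrightarrow> c > 0 \<Longrightarrow> p (c *\<^sub>R v) = c * p v"
  by (simp add: sublinear_def)

lemma sublinear_zero: "sublinear p \<Longrightarrow> p 0 = 0"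
  using sublinear_scale[of p 2 0] by simp

lemma sublinear_ge_neg: "sublinear p \<Longrightarrow> - p (- v) \<le> p v"
  using sublinear_add[of p v "- v"] by (simp add: sublinear_zero)

text \<open>
  The sublinear functionals below (a tilted one, the infimum of a chain, the distance to a
  subspace, an upper limit) are all pointwise infima of families \<open>S v\<close> of numbers in which the
  defining inequalities can be witnessed member by member; this lemma treats them together.
\<close>

lemma sublinear_Inf:
  fixes S :: "'a::real_vector \<Rightarrow> real set"
  assumes ne: "\<And>v. S v \<noteq> {}" and bdd: "\<And>v. bdd_below (S v)"
    and add: "\<And>v w a b. a \<in> S v \<Longrightarrow> b \<in> S w \<Longrightarrow> \<exists>c\<in>S (v + w). c \<le> a + b"
    and scale: "\<And>v a c. a \<in> S v \<Longrightarrow> c > 0 \<Longrightarrow> \<exists>b\<in>S (c *\<^sub>R v). b \<le> c * a"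
  shows "sublinear (\<lambda>v. Inf (S v))"
proof -
  have le: "Inf (S u) \<le> a" if "\<exists>b\<in>S u. b \<le> a" for u a
    using that bdd by (meson cInf_lower2)
  have sub: "Inf (S (v + w)) \<le> Inf (S v) + Inf (S w)" for v w
  proof -
    have "Inf (S (v + w)) - b \<le> Inf (S v)" if "b \<in> S w" for b
      using le[OF add[OF _ that]] by (intro cInf_greatest ne) (simp add: algebra_simps)
    then have "Inf (S (v + w)) - Inf (S v) \<le> Inf (S w)"
      by (intro cInf_greatest ne) (simp add: algebra_simps)
    then show ?thesis by simp
  qed
  have hom: "Inf (S (c *\<^sub>R v)) \<le> c * Inf (S v)" if "c > 0" for c v
  proof -
    have "Inf (S (c *\<^sub>R v)) / c \<le> Inf (S v)"
      using le[OF scale[OF _ that]] that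
      by (intro cInf_greatest ne) (simp add: field_simps)
    then show ?thesis using that by (simp add: field_simps)
  qed
  have "Inf (S (c *\<^sub>R v)) = c * Inf (S v)" if "c > 0" for c v
  proof (rule antisym[OF hom[OF that]])
    show "c * Inf (S v) \<le> Inf (S (c *\<^sub>R v))"
      using hom[of "1 / c" "c *\<^sub>R v"] that by (simp add: field_simps)
  qed
  with sub show ?thesis by (simp add: sublinear_def)
qed

text \<open>
  The largest sublinear functional below \<open>p\<close> whose value at \<open>- x\<close> is at most \<open>- p x\<close>
  is the infimum over \<open>t \<ge> 0\<close> of \<open>p (v + t x) - t p x\<close>.  A linear functional below it agrees
  with \<open>p\<close> at \<open>x\<close>, and a minimal sublinear \<open>p\<close> must equal its own tilts, which makes it odd.
\<close>

lemma sublinear_tilt: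
  fixes p :: "'a::real_vector \<Rightarrow> real"
  assumes p: "sublinear p"
  obtains q where "sublinear q" "q \<le> p" "q (- x) \<le> - p x"
proof
  define S where "S v = (\<lambda>t. p (v + t *\<^sub>R x) - t * p x) ` {0..}" for v
  have px: "p (t *\<^sub>R x) = t * p x" if "t \<ge> 0" for t
    using that sublinear_scale[OF p, of t x] sublinear_zero[OF p] by (cases "t = 0") auto
  have bdd: "bdd_below (S v)" for v
  proof (rule bdd_belowI)
    fix a assume "a \<in> S v"
    then obtain t where t: "t \<ge> 0" "a = p (v + t *\<^sub>R x) - t * p x" by (auto simp: S_def)
    show "- p (- v) \<le> a"
      using sublinear_add[OF p, of "v + t *\<^sub>R x" "- v"] t px[OF t(1)] by simp
  qed
  show "sublinear (\<lambda>v. Inf (S v))"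
  proof (rule sublinear_Inf[OF _ bdd])
    fix v w a b assume "a \<in> S v" "b \<in> S w"
    then obtain s t where st: "s \<ge> 0" "a = p (v + s *\<^sub>R x) - s * p x"
      "t \<ge> 0" "b = p (w + t *\<^sub>R x) - t * p x" by (auto simp: S_def)
    have "p ((v + w) + (s + t) *\<^sub>R x) - (s + t) * p x \<le> a + b"
      using sublinear_add[OF p, of "v + s *\<^sub>R x" "w + t *\<^sub>R x"] st by (simp add: algebra_simps)
    then show "\<exists>c\<in>S (v + w). c \<le> a + b"
      using st unfolding S_def by (intro bexI[OF _ imageI[of "s + t"]]) auto
  next
    fix v a and c :: real assume "a \<in> S v" "c > 0"
    then obtain t where t: "t \<ge> 0" "a = p (v + t *\<^sub>R x) - t * p x" by (auto simp: S_def)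
    have "p (c *\<^sub>R v + (c * t) *\<^sub>R x) - (c * t) * p x \<le> c * a"
      using sublinear_scale[OF p \<open>c > 0\<close>, of "v + t *\<^sub>R x"] t(2)
      by (simp add: scaleR_add_right right_diff_distrib mult.assoc)
    then show "\<exists>b\<in>S (c *\<^sub>R v). b \<le> c * a"
      using t \<open>c > 0\<close> unfolding S_def by (intro bexI[OF _ imageI[of "c * t"]]) auto
  qed (auto simp: S_def)
  show "(\<lambda>v. Inf (S v)) \<le> p"
  proof (rule le_funI)
    fix v
    have "p v \<in> S v" unfolding S_def by (rule image_eqI[of _ _ 0]) auto
    then show "Inf (S v) \<le> p v" by (rule cInf_lower[OF _ bdd])
  qed
  have "- p x \<in> S (- x)"
    unfolding S_def by (rule image_eqI[of _ _ 1]) (auto simp: sublinear_zero[OF p])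
  then show "Inf (S (- x)) \<le> - p x" by (rule cInf_lower[OF _ bdd])
qed

text \<open>
  Zorn's lemma for the reversed pointwise order.  The bound \<open>- p (- v)\<close>, common to all
  sublinear functionals below \<open>p\<close>, keeps the infimum of a chain finite.
\<close>

lemma ex_minimal_sublinear:
  fixes p :: "'a::real_vector \<Rightarrow> real"
  assumes p: "sublinear p"
  obtains m where "sublinear m" "m \<le> p" "\<And>q. sublinear q \<Longrightarrow> q \<le> m \<Longrightarrow> q = m"
proof -
  let ?S = "{q. sublinear q \<and> q \<le> p}"
  let ?P = "\<lambda>q r :: 'a \<Rightarrow> real. r \<le> q"
  have "\<exists>m\<in>?S. \<forall>q\<in>?S. ?P m q \<longrightarrow> q = m"
  proof (rule predicate_Zorn)
    show "partial_order_on ?S (relation_of ?P ?S)"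
      by (rule partial_order_on_relation_ofI) auto
    fix C assume C: "C \<in> Chains (relation_of ?P ?S)"
    then have sub: "q \<in> ?S" if "q \<in> C" for q
      using that by (auto simp: Chains_def relation_of_def)
    have total: "q \<le> r \<or> r \<le> q" if "q \<in> C" "r \<in> C" for q r
      using C that by (auto simp: Chains_def relation_of_def)
    show "\<exists>u\<in>?S. \<forall>q\<in>C. ?P q u"
    proof (cases "C = {}")
      case True
      then show ?thesis using p by auto
    next
      case False
      have bdd: "bdd_below ((\<lambda>q. q v) ` C)" for v
      proof (rule bdd_belowI2)
        fix q assume "q \<in> C"
        then have "- p (- v) \<le> - q (- v)" "- q (- v) \<le> q v"
          using sub[of q] by (auto simp: le_fun_def sublinear_ge_neg)
        then show "- p (- v) \<le> q v" by simp
      qed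
      have "sublinear (\<lambda>v. INF q\<in>C. q v)"
      proof (rule sublinear_Inf[OF _ bdd])
        fix v w a b assume "a \<in> (\<lambda>q. q v) ` C" "b \<in> (\<lambda>q. q w) ` C"
        then obtain q r where qr: "q \<in> C" "a = q v" "r \<in> C" "b = r w" by auto
        then obtain s where s: "s \<in> C" "s \<le> q" "s \<le> r"
          using total[of q r] by auto
        then have "s (v + w) \<le> a + b"
          using sublinear_add[of s v w] sub[of s] qr
          by (smt (verit) le_funD mem_Collect_eq)
        then show "\<exists>c\<in>(\<lambda>q. q (v + w)) ` C. c \<le> a + b" using s by blast
      next
        fix v a and c :: real assume "a \<in> (\<lambda>q. q v) ` C" "c > 0"
        then obtain q where "q \<in> C" "a = q v" "q (c *\<^sub>R v) = c * a"
          using sub sublinear_scale by blast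
        then show "\<exists>b\<in>(\<lambda>q. q (c *\<^sub>R v)) ` C. b \<le> c * a"
          by (intro bexI[OF _ imageI[of q]]) auto
      qed (use False in auto)
      moreover have below: "(\<lambda>v. INF q\<in>C. q v) \<le> q" if "q \<in> C" for q
        using that by (intro le_funI cINF_lower bdd)
      moreover have "(\<lambda>v. INF q\<in>C. q v) \<le> p"
        using False below sub by (metis (no_types, lifting) equals0I mem_Collect_eq order_trans)
      ultimately show ?thesis by blast
    qed
  qed
  then obtain m where "m \<in> ?S" and min: "\<And>q. q \<in> ?S \<Longrightarrow> q \<le> m \<Longrightarrow> q = m" by blast
  show thesis
  proof (rule that)
    show "sublinear m" "m \<le> p" using \<open>m \<in> ?S\<close> by auto
    then show "q = m" if "sublinear q" "q \<le> m" for q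
      using min that by (auto intro: order_trans)
  qed
qed

lemma minimal_sublinear_linear:
  fixes m :: "'a::real_vector \<Rightarrow> real"
  assumes m: "sublinear m" and min: "\<And>q. sublinear q \<Longrightarrow> q \<le> m \<Longrightarrow> q = m"
  shows "linear m"
proof -
  have neg: "m (- x) = - m x" for x
  proof (rule antisym)
    show "m (- x) \<le> - m x" using sublinear_tilt[OF m, of x] min by metis
    show "- m x \<le> m (- x)" using sublinear_ge_neg[OF m, of "- x"] by simp
  qed
  show ?thesis
  proof (rule linearI)
    fix v w
    show "m (v + w) = m v + m w"
      using sublinear_add[OF m, of v w] sublinear_add[OF m, of "- v" "- w"] neg[of "v + w"]
      by (simp add: neg)
  next
    fix c :: real and v
    consider "c > 0" | "c = 0" | "c < 0" by linarith
    then show "m (c *\<^sub>R v) = c *\<^sub>R m v"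
    proof cases
      case 3
      then show ?thesis using sublinear_scale[OF m, of "- c" v] neg[of "c *\<^sub>R v"] by simp
    qed (simp_all add: sublinear_scale[OF m] sublinear_zero[OF m])
  qed
qed

text \<open>
  Tilting \<open>p\<close> at \<open>x\<close> before passing to a minimal sublinear functional forces equality at \<open>x\<close>,
  so that no functional has to be extended from a subspace.
\<close>

theorem Hahn_Banach_sublinear:
  fixes p :: "'a::real_vector \<Rightarrow> real"
  assumes p: "sublinear p"
  obtains f where "linear f" "\<And>v. f v \<le> p v" "f x = p x"
proof -
  obtain q where q: "sublinear q" "q \<le> p" "q (- x) \<le> - p x" by (rule sublinear_tilt[OF p])
  obtain f where f: "sublinear f" "f \<le> q" "\<And>r. sublinear r \<Longrightarrow> r \<le> f \<Longrightarrow> r = f"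
    by (rule ex_minimal_sublinear[OF q(1)]) blast
  have lin: "linear f" using minimal_sublinear_linear[OF f(1)] f(3) by blast
  have le: "f v \<le> p v" for v using f(2) q(2) by (meson le_funD order_trans)
  have "f (- x) \<le> - p x" using f(2) q(3) by (meson le_funD order_trans)
  then have "f x = p x" using le[of x] linear_neg[OF lin, of x] by simp
  with lin le show thesis by (rule that)
qed

section \<open>Functionals annihilating a subspace\<close>

lemma sublinear_infdist:
  fixes M :: "'a::real_normed_vector set"
  assumes M: "subspace M"
  shows "sublinear (\<lambda>v. infdist v M)"
proof -
  have ne: "M \<noteq> {}" using subspace_0[OF M] by auto
  have "sublinear (\<lambda>v. INF m\<in>M. dist v m)"
  proof (rule sublinear_Inf)
    fix v w a b assume "a \<in> dist v ` M" "b \<in> dist w ` M"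
    then obtain m n where "m \<in> M" "a = dist v m" "n \<in> M" "b = dist w n" by auto
    then show "\<exists>c\<in>dist (v + w) ` M. c \<le> a + b"
      by (intro bexI[OF _ imageI[of "m + n"]]) (auto simp: dist_triangle_add subspace_add[OF M])
  next
    fix v a and c :: real assume "a \<in> dist v ` M" "c > 0"
    then obtain m where "m \<in> M" "a = dist v m" by auto
    then show "\<exists>b\<in>dist (c *\<^sub>R v) ` M. b \<le> c * a"
      using \<open>c > 0\<close>
      by (intro bexI[OF _ imageI[of "c *\<^sub>R m"]])
        (auto simp: subspace_scale[OF M] dist_norm simp flip: scaleR_diff_right)
  qed (use ne in \<open>auto intro: bdd_belowI2[of _ 0]\<close>)
  then show ?thesis using ne by (simp add: infdist_def)
qed

text \<open>
  A linear functional dominated by the distance to \<open>M\<close> is dominated by the norm and is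
  nonpositive on \<open>M\<close>, hence zero there by symmetry.
\<close>

lemma ex_annihilator_infdist:
  fixes M :: "'a::real_normed_vector set"
  assumes M: "subspace M"
  obtains f where "f \<in> annihilator M" "norm f \<le> 1" "blinfun_apply f x = infdist x M"
proof -
  obtain g where g: "linear g" "\<And>v. g v \<le> infdist v M" "g x = infdist x M"
    using Hahn_Banach_sublinear[OF sublinear_infdist[OF M]] by metis
  have le: "g v \<le> norm v" for v
    using g(2)[of v] infdist_le[OF subspace_0[OF M], of v] by simp
  have bound: "norm (g v) \<le> norm v * 1" for v
    using le[of v] le[of "- v"] linear_neg[OF g(1), of v] by auto
  have bl: "bounded_linear g"
    using g(1) bound unfolding bounded_linear_def bounded_linear_axioms_def by blast
  show thesis
  proof
    have "g m = 0" if "m \<in> M" for m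
      using g(2)[of m] g(2)[of "- m"] linear_neg[OF g(1), of m] that subspace_neg[OF M that]
      by simp
    then show "Blinfun g \<in> annihilator M"
      by (simp add: annihilator_def bounded_linear_Blinfun_apply[OF bl])
    show "norm (Blinfun g) \<le> 1"
      using bound by (intro norm_blinfun_bound) (auto simp: bounded_linear_Blinfun_apply[OF bl])
    show "blinfun_apply (Blinfun g) x = infdist x M"
      by (simp add: bounded_linear_Blinfun_apply[OF bl] g(3))
  qed
qed

lemma ex_norming_functional:
  fixes x :: "'a::real_normed_vector"
  obtains f where "norm f \<le> 1" "blinfun_apply f x = norm x"
  using ex_annihilator_infdist[of "{0}" x] by auto

text \<open>
  This is the characterization of Birkhoff--James orthogonality of \<open>x\<close> to \<open>M\<close> by a
  supporting functional.  It translates both \<open>C_dom\<close> and \<open>C_cod\<close> into best approximation.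
\<close>

lemma duality_map_annihilator_iff:
  fixes x :: "'a::real_normed_vector"
  assumes M: "subspace M"
  shows "duality_map x \<inter> annihilator M \<noteq> {} \<longleftrightarrow> (\<forall>m\<in>M. norm x \<le> norm (x - m))"
proof
  assume "duality_map x \<inter> annihilator M \<noteq> {}"
  then obtain f where "f \<in> duality_map x" "f \<in> annihilator M" by blast
  then have f: "blinfun_apply f x = (norm x)\<^sup>2" "norm x = norm f"
    "\<And>m. m \<in> M \<Longrightarrow> blinfun_apply f m = 0"
    by (auto simp: duality_map_def annihilator_def)
  show "\<forall>m\<in>M. norm x \<le> norm (x - m)"
  proof
    fix m assume "m \<in> M"
    then have "norm x * norm x = blinfun_apply f (x - m)"
      by (simp add: blinfun.diff_right f power2_eq_square)
    also have "\<dots> \<le> norm x * norm (x - m)"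
      using norm_blinfun[of f "x - m"] f(2) by simp
    finally show "norm x \<le> norm (x - m)"
      by (cases "x = 0") (auto simp: mult_le_cancel_left_pos)
  qed
next
  assume R: "\<forall>m\<in>M. norm x \<le> norm (x - m)"
  obtain f where f: "f \<in> annihilator M" "norm f \<le> 1" "blinfun_apply f x = infdist x M"
    using ex_annihilator_infdist[OF M] by metis
  have ne: "M \<noteq> {}" using subspace_0[OF M] by auto
  have "norm x \<le> infdist x M"
    using R ne by (auto simp: infdist_def dist_norm intro: cINF_greatest)
  then have eq: "blinfun_apply f x = norm x"
    using f(3) infdist_le[OF subspace_0[OF M], of x] by simp
  let ?g = "norm x *\<^sub>R f"
  have gx: "blinfun_apply ?g x = (norm x)\<^sup>2"
    by (simp add: scaleR_blinfun.rep_eq eq power2_eq_square)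
  have "norm ?g = norm x"
  proof (cases "x = 0")
    case False
    have "norm x \<le> norm f * norm x" using norm_blinfun[of f x] eq by simp
    then have "norm f = 1" using f(2) False by simp
    then show ?thesis by simp
  qed simp
  with gx have "?g \<in> duality_map x" by (simp add: duality_map_def)
  moreover have "?g \<in> annihilator M"
    using f(1) by (simp add: annihilator_def scaleR_blinfun.rep_eq)
  ultimately show "duality_map x \<inter> annihilator M \<noteq> {}" by blast
qed

section \<open>Weak cluster points in reflexive spaces\<close>

text \<open>
  On the dual space, the infimum of the eventual upper bounds of \<open>f (x i)\<close> is a sublinear
  functional of \<open>f\<close>.  A linear functional below it is a generalized limit, bounded because
  \<open>x\<close> is, and reflexivity realizes it by evaluation at a point \<open>w\<close>.  Applied to \<open>f\<close> and
  \<open>- f\<close>, the conclusion gives \<open>f w\<close> as the limit of \<open>f (x i)\<close> whenever that exists.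
\<close>

lemma reflexive_weak_cluster_point:
  fixes x :: "'i \<Rightarrow> 'a::real_normed_vector"
  assumes refl: "reflexive_space TYPE('a)" and F: "F \<noteq> bot"
    and bounded: "\<forall>\<^sub>F i in F. norm (x i) \<le> B"
  obtains w where
    "\<And>(f :: 'a \<Rightarrow>\<^sub>L real) c. \<forall>\<^sub>F i in F. blinfun_apply f (x i) \<le> c \<Longrightarrow> blinfun_apply f w \<le> c"
proof -
  define S where "S f = {c. \<forall>\<^sub>F i in F. blinfun_apply f (x i) \<le> c}" for f :: "'a \<Rightarrow>\<^sub>L real"
  have abs: "\<forall>\<^sub>F i in F. \<bar>blinfun_apply f (x i)\<bar> \<le> B * norm f" for f :: "'a \<Rightarrow>\<^sub>L real"
    using bounded
  proof eventually_elim
    case (elim i)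
    then show ?case
      using norm_blinfun[of f "x i"] mult_left_mono[OF elim norm_ge_zero[of f]]
      by (simp add: mult.commute)
  qed
  have upper: "B * norm f \<in> S f" for f
    unfolding S_def using abs[of f] by (auto elim: eventually_mono)
  have lower: "- (B * norm f) \<le> c" if "c \<in> S f" for f c
  proof -
    have "\<forall>\<^sub>F i in F. - (B * norm f) \<le> c"
      using abs[of f] that[unfolded S_def, simplified] by eventually_elim linarith
    then show ?thesis using F by simp
  qed
  have bdd: "bdd_below (S f)" for f using lower by (rule bdd_belowI)
  have sub: "sublinear (\<lambda>f. Inf (S f))"
  proof (rule sublinear_Inf[OF _ bdd])
    fix f g a b assume "a \<in> S f" "b \<in> S g"
    then have "a + b \<in> S (f + g)"
      unfolding S_def mem_Collect_eq by eventually_elim (simp add: plus_blinfun.rep_eq)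
    then show "\<exists>c\<in>S (f + g). c \<le> a + b" by blast
  next
    fix f a and c :: real assume "a \<in> S f" "c > 0"
    then have "c * a \<in> S (c *\<^sub>R f)"
      by (simp add: S_def scaleR_blinfun.rep_eq)
    then show "\<exists>b\<in>S (c *\<^sub>R f). b \<le> c * a" by blast
  qed (use upper in blast)
  obtain \<phi> where \<phi>: "linear \<phi>" "\<And>f. \<phi> f \<le> Inf (S f)"
    using Hahn_Banach_sublinear[OF sub] by metis
  have le: "\<phi> f \<le> c" if "c \<in> S f" for f c
    using \<phi>(2)[of f] cInf_lower[OF that bdd] by simp
  have "norm (\<phi> f) \<le> norm f * B" for f
    using le[OF upper[of f]] le[OF upper[of "- f"]] linear_neg[OF \<phi>(1), of f]
    by (auto simp: mult.commute)
  then have bl: "bounded_linear \<phi>"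
    using \<phi>(1) by (auto simp: bounded_linear_def bounded_linear_axioms_def)
  obtain w where w: "\<And>f. blinfun_apply (Blinfun \<phi>) f = blinfun_apply f w"
    using refl unfolding reflexive_space_def by blast
  show thesis
  proof
    fix f :: "'a \<Rightarrow>\<^sub>L real" and c assume "\<forall>\<^sub>F i in F. blinfun_apply f (x i) \<le> c"
    then have "\<phi> f \<le> c" by (intro le) (simp add: S_def)
    then show "blinfun_apply f w \<le> c"
      using w[of f] by (simp add: bounded_linear_Blinfun_apply[OF bl])
  qed
qed

text \<open>
  This is the mechanism by which images of closed balls are closed: the weak cluster point \<open>w\<close>
  of \<open>x\<close> satisfies \<open>g (A w) \<le> g z\<close> for every functional \<open>g\<close>, in particular for one that norms \<open>A w - z\<close>.
\<close>

lemma reflexive_range_bounded_limit: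
  fixes A :: "'a::real_normed_vector \<Rightarrow>\<^sub>L 'b::real_normed_vector"
  assumes refl: "reflexive_space TYPE('a)" and F: "F \<noteq> bot"
    and bounded: "\<forall>\<^sub>F i in F. norm (x i) \<le> B"
    and lim: "((\<lambda>i. blinfun_apply A (x i)) \<longlongrightarrow> z) F"
  shows "z \<in> range_space A"
proof -
  obtain w where
    w: "\<And>(f :: 'a \<Rightarrow>\<^sub>L real) c. \<forall>\<^sub>F i in F. blinfun_apply f (x i) \<le> c \<Longrightarrow> blinfun_apply f w \<le> c"
    by (rule reflexive_weak_cluster_point[OF refl F bounded]) blast
  obtain g where g: "blinfun_apply g (blinfun_apply A w - z) = norm (blinfun_apply A w - z)"
    using ex_norming_functional by metis
  have "((\<lambda>i. blinfun_apply g (blinfun_apply A (x i))) \<longlongrightarrow> blinfun_apply g z) F"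
    by (intro tendsto_intros lim)
  then have less: "\<forall>\<^sub>F i in F. blinfun_apply g (blinfun_apply A (x i)) < blinfun_apply g z + e"
    if "e > 0" for e
    using that by (intro order_tendstoD(2)) auto
  have "blinfun_apply (g o\<^sub>L A) w \<le> blinfun_apply g z + e" if "e > 0" for e
    by (rule w, rule eventually_mono[OF less[OF that]]) simp
  then have "blinfun_apply (g o\<^sub>L A) w \<le> blinfun_apply g z" by (rule field_le_epsilon)
  then have "norm (blinfun_apply A w - z) \<le> 0" by (simp flip: g add: blinfun.diff_right)
  then show ?thesis by (auto simp: range_space_def)
qed

section \<open>Best approximation by subspaces\<close>

text \<open>
  For a minimizing sequence \<open>u\<close>, a weak cluster point \<open>w\<close> of \<open>z - u k\<close> has norm at most the
  distance of \<open>z\<close> to \<open>U\<close>, by testing with a functional norming \<open>w\<close>; and \<open>z - w\<close> stays in \<open>U\<close>,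
  by testing with a functional that annihilates \<open>U\<close> and detects the distance of \<open>z - w\<close> to \<open>U\<close>.
\<close>

lemma reflexive_ex_best_approximation:
  fixes U :: "'a::real_normed_vector set"
  assumes refl: "reflexive_space TYPE('a)" and U: "subspace U" "closed U"
  obtains u where "u \<in> U" "\<And>v. v \<in> U \<Longrightarrow> norm (z - u) \<le> norm (z - v)"
proof -
  have ne: "U \<noteq> {}" using subspace_0[OF U(1)] by auto
  have "\<exists>u\<in>U. dist z u < infdist z U + 1 / Suc k" for k
  proof -
    have "(INF u\<in>U. dist z u) < infdist z U + 1 / Suc k" using ne by (simp add: infdist_def)
    then show ?thesis using ne by (subst (asm) cINF_less_iff) auto
  qed
  then obtain u where u: "\<And>k. u k \<in> U" "\<And>k. norm (z - u k) < infdist z U + 1 / Suc k"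
    unfolding dist_norm by metis
  have "norm (z - u k) \<le> infdist z U + 1" for k
    by (rule order_trans[OF less_imp_le[OF u(2)[of k]]]) simp
  then have bounded: "\<forall>\<^sub>F k in sequentially. norm (z - u k) \<le> infdist z U + 1"
    by (intro always_eventually allI)
  obtain w where
    w: "\<And>(f :: 'a \<Rightarrow>\<^sub>L real) c.
      \<forall>\<^sub>F k in sequentially. blinfun_apply f (z - u k) \<le> c \<Longrightarrow> blinfun_apply f w \<le> c"
    by (rule reflexive_weak_cluster_point[OF refl sequentially_bot bounded]) blast
  obtain f where f: "norm f \<le> 1" "blinfun_apply f w = norm w"
    using ex_norming_functional by metis
  have w_le: "norm w \<le> infdist z U"
  proof (rule field_le_epsilon)
    fix e :: real assume "e > 0"
    then have "\<forall>\<^sub>F k in sequentially. 1 / real (Suc k) < e"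
      using order_tendstoD(2)[OF LIMSEQ_inverse_real_of_nat] by (simp add: divide_inverse)
    then have "\<forall>\<^sub>F k in sequentially. blinfun_apply f (z - u k) \<le> infdist z U + e"
    proof eventually_elim
      case (elim k)
      have "blinfun_apply f (z - u k) \<le> norm f * norm (z - u k)"
        using norm_blinfun[of f "z - u k"] by simp
      also have "\<dots> \<le> norm (z - u k)" using f(1) by (simp add: mult_left_le_one_le)
      finally show ?case using u(2)[of k] elim by simp
    qed
    then have "blinfun_apply f w \<le> infdist z U + e" by (rule w)
    then show "norm w \<le> infdist z U + e" using f(2) by simp
  qed
  obtain g where g: "g \<in> annihilator U" "blinfun_apply g (z - w) = infdist (z - w) U"
    using ex_annihilator_infdist[OF U(1)] by metis
  have "blinfun_apply (- g) (z - u k) \<le> - blinfun_apply g z" for k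
    using g(1) u(1) by (simp add: annihilator_def blinfun.diff_right uminus_blinfun.rep_eq)
  then have "blinfun_apply (- g) w \<le> - blinfun_apply g z" by (intro w) simp
  then have "infdist (z - w) U \<le> 0"
    by (simp flip: g(2) add: blinfun.diff_right uminus_blinfun.rep_eq)
  then have "infdist (z - w) U = 0" using infdist_nonneg[of "z - w" U] by linarith
  then have mem: "z - w \<in> U" using in_closed_iff_infdist_zero[OF U(2) ne] by simp
  have "norm (z - (z - w)) \<le> norm (z - v)" if "v \<in> U" for v
    using w_le infdist_le[OF that, of z] by (simp add: dist_norm)
  with mem show thesis by (rule that)
qed

lemma strictly_convex_midpoint:
  fixes a b :: "'a::real_normed_vector"
  assumes sc: "strictly_convex_space TYPE('a)" and eq: "norm a = norm b"
    and mid: "norm a \<le> norm ((1 / 2) *\<^sub>R (a + b))"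
  shows "a = b"
proof (rule ccontr)
  assume ne: "a \<noteq> b"
  then have pos: "norm a > 0" using eq by auto
  let ?s = "1 / norm a"
  have "norm ((1 / 2) *\<^sub>R (?s *\<^sub>R a + ?s *\<^sub>R b)) < 1"
    using sc ne pos eq unfolding strictly_convex_space_def by auto
  also have "(1 / 2) *\<^sub>R (?s *\<^sub>R a + ?s *\<^sub>R b) = ?s *\<^sub>R ((1 / 2) *\<^sub>R (a + b))"
    by (simp add: algebra_simps)
  finally have "(1 / norm a) * norm ((1 / 2) *\<^sub>R (a + b)) < 1"
    by (simp only: norm_scaleR) simp
  with mult_left_mono[OF mid, of "1 / norm a"] pos show False by simp
qed

lemma strictly_convex_best_approximation_unique:
  fixes U :: "'a::real_normed_vector set"
  assumes sc: "strictly_convex_space TYPE('a)" and U: "subspace U"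
    and u: "u \<in> U" "\<And>v. v \<in> U \<Longrightarrow> norm (z - u) \<le> norm (z - v)"
    and u': "u' \<in> U" "norm (z - u') \<le> norm (z - u)"
  shows "u' = u"
proof -
  have eq: "norm (z - u) = norm (z - u')" using u(2)[OF u'(1)] u'(2) by simp
  have "(1 / 2) *\<^sub>R (u + u') \<in> U" using U u(1) u'(1) by (intro subspace_scale subspace_add)
  from u(2)[OF this] have "norm (z - u) \<le> norm (z - (1 / 2) *\<^sub>R (u + u'))" .
  also have "z - (1 / 2) *\<^sub>R (u + u') = (1 / 2) *\<^sub>R ((z - u) + (z - u'))"
    by (simp add: algebra_simps flip: scaleR_add_left)
  finally have "z - u = z - u'" using strictly_convex_midpoint[OF sc eq] by simp
  then show ?thesis by simp
qed

lemma metric_projection_eqI: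
  fixes U :: "'a::real_normed_vector set"
  assumes sc: "strictly_convex_space TYPE('a)" and U: "subspace U"
    and u: "u \<in> U" "\<And>v. v \<in> U \<Longrightarrow> norm (z - u) \<le> norm (z - v)"
  shows "metric_projection U z = u"
proof -
  have "(INF v\<in>U. norm (z - v)) = norm (z - u)"
    using u by (intro cInf_eq_minimum) auto
  then show ?thesis
    unfolding metric_projection_def
    using u strictly_convex_best_approximation_unique[OF sc U u] by (intro the_equality) auto
qed

section \<open>The metric generalized inverse\<close>

lemma subspace_null_space: "subspace (null_space A)"
  by (simp add: null_space_def subspace_def blinfun.add_right blinfun.scaleR_right)

lemma closed_null_space: "closed (null_space A)"
  unfolding null_space_def by (intro closed_Collect_eq continuous_intros)

lemma subspace_range_space: "subspace (range_space A)"
  unfolding range_space_def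
  by (intro linear_subspace_image bounded_linear.linear blinfun.bounded_linear_right subspace_UNIV)

lemma subspace_closure:
  fixes M :: "'a::real_normed_vector set"
  assumes M: "subspace M"
  shows "subspace (closure M)"
proof (rule subspaceI)
  show "0 \<in> closure M" using subspace_0[OF M] closure_subset by blast
next
  fix v w assume "v \<in> closure M" "w \<in> closure M"
  then obtain f g where "\<And>n. f n \<in> M" "f \<longlonglongrightarrow> v" "\<And>n. g n \<in> M" "g \<longlonglongrightarrow> w"
    by (auto simp: closure_sequential)
  then have "\<forall>n. f n + g n \<in> M" "(\<lambda>n. f n + g n) \<longlonglongrightarrow> v + w"
    by (auto intro: subspace_add[OF M] tendsto_add)
  then show "v + w \<in> closure M" unfolding closure_sequential
    by (intro exI[of _ "\<lambda>n. f n + g n"] conjI)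
next
  fix c v assume "v \<in> closure M"
  then obtain f where "\<And>n. f n \<in> M" "f \<longlonglongrightarrow> v"
    by (auto simp: closure_sequential)
  then have "\<forall>n. c *\<^sub>R f n \<in> M" "(\<lambda>n. c *\<^sub>R f n) \<longlonglongrightarrow> c *\<^sub>R v"
    by (auto intro: subspace_scale[OF M] tendsto_scaleR)
  then show "c *\<^sub>R v \<in> closure M" unfolding closure_sequential
    by (intro exI[of _ "\<lambda>n. c *\<^sub>R f n"] conjI)
qed

text \<open>
  The fibre of \<open>A\<close> through \<open>x\<close> is the translate of the null space by \<open>x\<close>, so being best
  approximated from the null space by \<open>0\<close> means having minimal norm in the fibre.
\<close>

lemma mem_C_dom_iff:
  "x \<in> C_dom A \<longleftrightarrow> (\<forall>x'. blinfun_apply A x' = blinfun_apply A x \<longrightarrow> norm x \<le> norm x')"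
proof -
  have "x \<in> C_dom A \<longleftrightarrow> (\<forall>n\<in>null_space A. norm x \<le> norm (x - n))"
    by (simp add: C_dom_def duality_map_annihilator_iff[OF subspace_null_space])
  also have "\<dots> \<longleftrightarrow> (\<forall>x'. x - x' \<in> null_space A \<longrightarrow> norm x \<le> norm x')"
    by (metis diff_diff_eq2 add_diff_cancel_left')
  finally show ?thesis by (auto simp: null_space_def blinfun.diff_right)
qed

lemma mem_C_cod_iff: "c \<in> C_cod A \<longleftrightarrow> (\<forall>r\<in>range_space A. norm c \<le> norm (c - r))"
  by (simp add: C_cod_def duality_map_annihilator_iff[OF subspace_range_space])

lemma residual_minimizer_iff:
  "residual_minimizer A y x \<longleftrightarrow>
    (\<forall>r\<in>range_space A. norm (y - blinfun_apply A x) \<le> norm (y - r))"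
  by (auto simp: residual_minimizer_def is_arg_min_def range_space_def not_less norm_minus_commute)

text \<open>
  In a decomposition of \<open>y\<close> into \<open>A x\<close> and an element of \<open>C_cod A\<close>, the latter is the residual
  \<open>y - A x\<close>, and it lies in \<open>C_cod A\<close> iff \<open>A x\<close> is a best approximation of \<open>y\<close> from the range,
  since the range is invariant under translation by \<open>A x\<close>.
\<close>

lemma mem_mgi_domain_iff: "y \<in> mgi_domain A \<longleftrightarrow> (\<exists>x. residual_minimizer A y x)"
proof -
  have shift: "y - blinfun_apply A x \<in> C_cod A \<longleftrightarrow> residual_minimizer A y x" for x
  proof -
    have "(\<forall>r\<in>range_space A. norm (y - blinfun_apply A x) \<le> norm (y - blinfun_apply A x - r)) \<longleftrightarrow>
        (\<forall>r\<in>range_space A. norm (y - blinfun_apply A x) \<le> norm (y - r))"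
    proof (intro iffI ballI)
      fix r assume L: "\<forall>r\<in>range_space A. norm (y - blinfun_apply A x) \<le> norm (y - blinfun_apply A x - r)"
        and "r \<in> range_space A"
      then have "r - blinfun_apply A x \<in> range_space A"
        by (intro subspace_diff[OF subspace_range_space]) (auto simp: range_space_def)
      with L show "norm (y - blinfun_apply A x) \<le> norm (y - r)" by fastforce
    next
      fix r assume R: "\<forall>r\<in>range_space A. norm (y - blinfun_apply A x) \<le> norm (y - r)"
        and "r \<in> range_space A"
      then have "blinfun_apply A x + r \<in> range_space A"
        by (intro subspace_add[OF subspace_range_space]) (auto simp: range_space_def)
      with R show "norm (y - blinfun_apply A x) \<le> norm (y - blinfun_apply A x - r)"
        by (metis diff_diff_eq)
    qed
    then show ?thesis by (simp add: mem_C_cod_iff residual_minimizer_iff)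
  qed
  have "y \<in> mgi_domain A \<longleftrightarrow> (\<exists>x. y - blinfun_apply A x \<in> C_cod A)"
  proof
    assume "y \<in> mgi_domain A"
    then obtain x c where "y = blinfun_apply A x + c" "c \<in> C_cod A"
      by (auto simp: mgi_domain_def range_space_def)
    then have "y - blinfun_apply A x \<in> C_cod A" by simp
    then show "\<exists>x. y - blinfun_apply A x \<in> C_cod A" ..
  next
    assume "\<exists>x. y - blinfun_apply A x \<in> C_cod A"
    then obtain x where "y - blinfun_apply A x \<in> C_cod A" ..
    moreover have "y = blinfun_apply A x + (y - blinfun_apply A x)" by simp
    ultimately show "y \<in> mgi_domain A"
      unfolding mgi_domain_def range_space_def by blast
  qed
  then show ?thesis by (simp add: shift)
qed

text \<open>
  The inequality that makes \<open>A x\<close> a best approximation from the range passes to the closure by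
  continuity of the norm; uniqueness then identifies \<open>A x\<close> with the projection.
\<close>

lemma metric_projection_residual_minimizer:
  fixes A :: "'a::real_normed_vector \<Rightarrow>\<^sub>L 'b::real_normed_vector"
  assumes sc: "strictly_convex_space TYPE('b)" and x: "residual_minimizer A y x"
  shows "metric_projection (closure (range_space A)) y = blinfun_apply A x"
proof (rule metric_projection_eqI[OF sc])
  show "subspace (closure (range_space A))"
    by (rule subspace_closure[OF subspace_range_space])
  show "blinfun_apply A x \<in> closure (range_space A)"
    unfolding range_space_def by (rule subsetD[OF closure_subset rangeI])
  fix v assume "v \<in> closure (range_space A)"
  moreover have "closed {v. norm (y - blinfun_apply A x) \<le> norm (y - v)}"
    by (intro closed_Collect_le continuous_intros)
  then have "closure (range_space A) \<subseteq> {v. norm (y - blinfun_apply A x) \<le> norm (y - v)}"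
    using x by (intro closure_minimal) (auto simp: residual_minimizer_iff)
  ultimately show "norm (y - blinfun_apply A x) \<le> norm (y - v)" by blast
qed

lemma residual_minimizers_eq_fibre:
  fixes A :: "'a::real_normed_vector \<Rightarrow>\<^sub>L 'b::real_normed_vector"
  assumes sc: "strictly_convex_space TYPE('b)" and y: "y \<in> mgi_domain A"
  shows "residual_minimizer A y x \<longleftrightarrow>
    blinfun_apply A x = metric_projection (closure (range_space A)) y"
proof -
  obtain x0 where x0: "residual_minimizer A y x0" using y by (auto simp: mem_mgi_domain_iff)
  show ?thesis
    using metric_projection_residual_minimizer[OF sc] x0 by (metis residual_minimizer_iff)
qed

text \<open>
  Two norm-minimal elements of one fibre have equal norms, and their midpoint, which lies in the
  fibre too, cannot be shorter.
\<close>

lemma inj_on_C_dom: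
  fixes A :: "'a::real_normed_vector \<Rightarrow>\<^sub>L 'b::real_normed_vector"
  assumes sc: "strictly_convex_space TYPE('a)"
  shows "inj_on (blinfun_apply A) (C_dom A)"
proof (rule inj_onI)
  fix x x' assume C: "x \<in> C_dom A" "x' \<in> C_dom A" and A: "blinfun_apply A x = blinfun_apply A x'"
  have min: "norm x \<le> norm v" if "blinfun_apply A v = blinfun_apply A x" for v
    using C(1) that by (simp add: mem_C_dom_iff)
  have eq: "norm x = norm x'" using C A by (intro antisym) (simp_all add: mem_C_dom_iff)
  have "blinfun_apply A ((1 / 2) *\<^sub>R (x + x')) = blinfun_apply A x"
    by (simp add: blinfun.scaleR_right blinfun.add_right A[symmetric] flip: scaleR_2)
  then have "norm x \<le> norm ((1 / 2) *\<^sub>R (x + x'))" by (rule min)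
  then show "x = x'" by (rule strictly_convex_midpoint[OF sc eq])
qed

text \<open>
  Subtracting from a preimage \<open>x\<close> its best approximation in the null space leaves a
  norm-minimal preimage.
\<close>

lemma C_dom_onto_range_space:
  fixes A :: "'a::real_normed_vector \<Rightarrow>\<^sub>L 'b::real_normed_vector"
  assumes refl: "reflexive_space TYPE('a)"
  shows "blinfun_apply A ` C_dom A = range_space A"
proof
  show "range_space A \<subseteq> blinfun_apply A ` C_dom A"
  proof
    fix r assume "r \<in> range_space A"
    then obtain x where x: "r = blinfun_apply A x" by (auto simp: range_space_def)
    obtain n where n: "n \<in> null_space A" "\<And>v. v \<in> null_space A \<Longrightarrow> norm (x - n) \<le> norm (x - v)"
      using reflexive_ex_best_approximation[OF refl subspace_null_space closed_null_space] by metis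
    have "r = blinfun_apply A (x - n)"
      using n(1) by (simp add: x null_space_def blinfun.diff_right)
    moreover have "x - n \<in> C_dom A"
      unfolding mem_C_dom_iff
    proof (intro allI impI)
      fix x' assume "blinfun_apply A x' = blinfun_apply A (x - n)"
      then have "x - x' \<in> null_space A"
        using n(1) by (simp add: null_space_def blinfun.diff_right)
      from n(2)[OF this] show "norm (x - n) \<le> norm x'" by simp
    qed
    ultimately show "r \<in> blinfun_apply A ` C_dom A" by (rule image_eqI)
  qed
qed (auto simp: range_space_def)

text \<open>
  The residual minimizers form the fibre of \<open>A\<close> over the projection of \<open>y\<close>, and \<open>mgi A y\<close> is
  its only element in \<open>C_dom A\<close>, that is, its only element of minimal norm.
\<close>

lemma minimum_norm_solution_mgi:
  fixes A :: "'a::real_normed_vector \<Rightarrow>\<^sub>L 'b::real_normed_vector"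
  assumes reflX: "reflexive_space TYPE('a)" and scX: "strictly_convex_space TYPE('a)"
    and scY: "strictly_convex_space TYPE('b)" and y: "y \<in> mgi_domain A"
  shows "minimum_norm_solution A y (mgi A y)"
proof -
  let ?r = "metric_projection (closure (range_space A)) y"
  note fibre = residual_minimizers_eq_fibre[OF scY y]
  have "?r \<in> blinfun_apply A ` C_dom A"
    unfolding C_dom_onto_range_space[OF reflX]
    using y fibre unfolding mem_mgi_domain_iff range_space_def by (metis rangeI)
  then have mem: "mgi A y \<in> C_dom A" and val: "blinfun_apply A (mgi A y) = ?r"
    unfolding mgi_def
    by (auto intro: the_inv_into_into f_the_inv_into_f inj_on_C_dom[OF scX])
  show ?thesis
    unfolding minimum_norm_solution_def
  proof (intro allI iffI)
    fix z assume z: "is_arg_min norm (residual_minimizer A y) z"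
    then have Az: "blinfun_apply A z = ?r" by (simp add: is_arg_min_def fibre)
    have "z \<in> C_dom A"
      using z by (auto simp: is_arg_min_def mem_C_dom_iff fibre Az not_less)
    then show "z = mgi A y"
      using inj_on_C_dom[OF scX] mem Az val by (metis inj_onD)
  next
    fix z assume "z = mgi A y"
    then show "is_arg_min norm (residual_minimizer A y) z"
      using mem by (auto simp: is_arg_min_def mem_C_dom_iff fibre val not_less)
  qed
qed

text \<open>
  Existence and uniqueness of best approximations ensure that the value of
  \<open>metric_projection\<close>, a definite description, really is a best approximation.  If it equals
  \<open>A x\<close>, then \<open>x\<close> minimizes the residual.
\<close>

lemma metric_projection_in_range_imp_mgi_domain:
  fixes A :: "'a::real_normed_vector \<Rightarrow>\<^sub>L 'b::real_normed_vector"
  assumes refl: "reflexive_space TYPE('b)" and sc: "strictly_convex_space TYPE('b)"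
    and r: "metric_projection (closure (range_space A)) y \<in> range_space A"
  shows "y \<in> mgi_domain A"
proof -
  have U: "subspace (closure (range_space A))"
    by (rule subspace_closure[OF subspace_range_space])
  obtain u where u: "u \<in> closure (range_space A)"
    "\<And>v. v \<in> closure (range_space A) \<Longrightarrow> norm (y - u) \<le> norm (y - v)"
    using reflexive_ex_best_approximation[OF refl U closed_closure] by metis
  then have "metric_projection (closure (range_space A)) y = u"
    by (intro metric_projection_eqI[OF sc U])
  with r obtain x where "u = blinfun_apply A x" by (auto simp: range_space_def)
  then have "residual_minimizer A y x"
    using u(2) closure_subset by (auto simp: residual_minimizer_iff)
  then show ?thesis by (auto simp: mem_mgi_domain_iff)
qed

section \<open>Convergence or blow-up\<close>

theorem theorem1:
  fixes A :: "'a::banach \<Rightarrow>\<^sub>L 'b::banach"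
    and X :: "nat \<Rightarrow> 'b \<Rightarrow> 'a"
    and y :: 'b
  assumes "reflexive_space TYPE('a)" and "strictly_convex_space TYPE('a)"
    and "reflexive_space TYPE('b)" and "strictly_convex_space TYPE('b)"
    and "sequential_regularization A X"
  shows "(y \<in> mgi_domain A \<and> minimum_norm_solution A y (mgi A y) \<and> (\<lambda>k. X k y) \<longlonglongrightarrow> mgi A y)
       \<or> (y \<notin> mgi_domain A \<and> filterlim (\<lambda>k. norm (X k y)) at_top sequentially)"
proof (cases "y \<in> mgi_domain A")
  case True
  then show ?thesis
    using minimum_norm_solution_mgi[OF assms(1,2,4)] assms(5)
    by (simp add: sequential_regularization_def)
next
  case False
  let ?z = "metric_projection (closure (range_space A)) y"
  have lim: "(\<lambda>k. blinfun_apply A (X k y)) \<longlonglongrightarrow> ?z"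
    using assms(5) by (simp add: sequential_regularization_def)
  have "filterlim (\<lambda>k. norm (X k y)) at_top sequentially"
  proof (rule ccontr)
    assume "\<not> filterlim (\<lambda>k. norm (X k y)) at_top sequentially"
    then obtain B where B: "\<not> (\<forall>\<^sub>F k in sequentially. B \<le> norm (X k y))"
      by (auto simp: filterlim_at_top)
    \<comment> \<open>The trace of \<open>sequentially\<close> on the indices with bounded norm replaces a subsequence.\<close>
    let ?F = "inf sequentially (principal {k. norm (X k y) \<le> B})"
    have "?F \<noteq> bot"
    proof
      assume "?F = bot"
      then have "\<forall>\<^sub>F k in sequentially. \<not> norm (X k y) \<le> B"
        by (simp add: trivial_limit_def eventually_inf_principal)
      then have "\<forall>\<^sub>F k in sequentially. B \<le> norm (X k y)" by eventually_elim simp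
      with B show False by simp
    qed
    moreover have "\<forall>\<^sub>F k in ?F. norm (X k y) \<le> B" by (simp add: eventually_inf_principal)
    moreover have "((\<lambda>k. blinfun_apply A (X k y)) \<longlongrightarrow> ?z) ?F"
      using lim by (rule tendsto_mono[rotated]) simp
    ultimately have "?z \<in> range_space A" by (rule reflexive_range_bounded_limit[OF assms(1)])
    with False show False using metric_projection_in_range_imp_mgi_domain[OF assms(3,4)] by blast
  qed
  with False show ?thesis by simp
qed

end
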